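(* Let $\mathbb{E}$ be a regular category, $(R,S)$ any pair of reflexive relations on an object $X$, and $n\geq 2$ an integer. The following conditions are equivalent: 1) $(R,S)_{n+2}=(R,S)_{n}$; 2) the chain $((R,S))$ is stationary from $n$, i.e. $(R,S)_{n+k}=(R,S)_n$ for all $k\geq 1$; 3) the reflexive relation $(R,S)_{n}$ is a preorder.
   Context: A relation on $X$ is (a class up to isomorphism of) a subobject $R\rightarrowtail X\times X$, ordered by inclusion. In a regular category relations compose: $SR=S\circ R$ is the usual composite relation ($x(SR)z$ iff there is $y$ with $xRy$ and $ySz$), defined by a pullback followed by the regular epi–mono factorization. $R$ is reflexive if $\Delta_X\subset R$, transitive if $R\circ R\subset R$; a preorder is a reflexive transitive relation. For reflexive relations $R,S$ on $X$, the chain $((R,S))$ is $\Delta_X\subset R\subset RS\subset RSR\subset RSRS\subset\cdots$, with terms $(R,S)_0=\Delta_X$, $(R,S)_1=R$, $(R,S)_2=RS$, $(R,S)_3=RSR$, and in general $(R,S)_n$ is the alternating product of $n$ factors beginning with $R$. *)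

theory Defs
  imports Main
begin

section \<open>Categories\<close>

record ('o, 'm) precategory =
  Obj :: "'o set"
  Arr :: "'m set"
  Dom :: "'m \<Rightarrow> 'o"
  Cod :: "'m \<Rightarrow> 'o"
  Ident :: "'o \<Rightarrow> 'm"
  Comp :: "'m \<Rightarrow> 'm \<Rightarrow> 'm" (infixr "\<cdot>\<index>" 70)  (* g \<cdot> f is f followed by g *)

definition Hom :: "('o, 'm) precategory \<Rightarrow> 'o \<Rightarrow> 'o \<Rightarrow> 'm set" where
  "Hom C X Y = {f \<in> Arr C. Dom C f = X \<and> Cod C f = Y}"

locale category =
  fixes C :: "('o, 'm) precategory" (structure)
  assumes dom_obj: "f \<in> Arr C \<Longrightarrow> Dom C f \<in> Obj C"
    and cod_obj: "f \<in> Arr C \<Longrightarrow> Cod C f \<in> Obj C"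
    and ident_hom: "X \<in> Obj C \<Longrightarrow> Ident C X \<in> Hom C X X"
    and comp_hom: "f \<in> Hom C X Y \<Longrightarrow> g \<in> Hom C Y Z \<Longrightarrow> g \<cdot> f \<in> Hom C X Z"
    and ident_left: "f \<in> Hom C X Y \<Longrightarrow> Ident C Y \<cdot> f = f"
    and ident_right: "f \<in> Hom C X Y \<Longrightarrow> f \<cdot> Ident C X = f"
    and comp_assoc: "f \<in> Hom C W X \<Longrightarrow> g \<in> Hom C X Y \<Longrightarrow> h \<in> Hom C Y Z \<Longrightarrow>
      (h \<cdot> g) \<cdot> f = h \<cdot> (g \<cdot> f)"

definition is_mono :: "('o, 'm) precategory \<Rightarrow> 'm \<Rightarrow> bool" where
  "is_mono C m \<longleftrightarrow> m \<in> Arr C \<and>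
    (\<forall>A f g. f \<in> Hom C A (Dom C m) \<longrightarrow> g \<in> Hom C A (Dom C m) \<longrightarrow>
      m \<cdot>\<^bsub>C\<^esub> f = m \<cdot>\<^bsub>C\<^esub> g \<longrightarrow> f = g)"

definition is_iso :: "('o, 'm) precategory \<Rightarrow> 'm \<Rightarrow> bool" where
  "is_iso C i \<longleftrightarrow> i \<in> Arr C \<and>
    (\<exists>j \<in> Hom C (Cod C i) (Dom C i).
      j \<cdot>\<^bsub>C\<^esub> i = Ident C (Dom C i) \<and> i \<cdot>\<^bsub>C\<^esub> j = Ident C (Cod C i))"

section \<open>Limits and coequalizers\<close>

text \<open>
  A diagram is a morphism from a directed graph (vertices \<open>V\<close>, edges \<open>E\<close>, source \<open>s\<close>, target \<open>t\<close>)
  to the underlying graph of the category. As finite graphs have copies with vertices and edges in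
  the natural numbers, those are enough to speak of all finite limits.
\<close>

definition is_diagram :: "('o, 'm) precategory \<Rightarrow> nat set \<Rightarrow> nat set \<Rightarrow> (nat \<Rightarrow> nat) \<Rightarrow> (nat \<Rightarrow> nat) \<Rightarrow>
    (nat \<Rightarrow> 'o) \<Rightarrow> (nat \<Rightarrow> 'm) \<Rightarrow> bool" where
  "is_diagram C V E s t D d \<longleftrightarrow> (\<forall>v\<in>V. D v \<in> Obj C) \<and>
    (\<forall>e\<in>E. s e \<in> V \<and> t e \<in> V \<and> d e \<in> Hom C (D (s e)) (D (t e)))"

definition is_cone :: "('o, 'm) precategory \<Rightarrow> nat set \<Rightarrow> nat set \<Rightarrow> (nat \<Rightarrow> nat) \<Rightarrow> (nat \<Rightarrow> nat) \<Rightarrow>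
    (nat \<Rightarrow> 'o) \<Rightarrow> (nat \<Rightarrow> 'm) \<Rightarrow> 'o \<Rightarrow> (nat \<Rightarrow> 'm) \<Rightarrow> bool" where
  "is_cone C V E s t D d L p \<longleftrightarrow> L \<in> Obj C \<and> (\<forall>v\<in>V. p v \<in> Hom C L (D v)) \<and>
    (\<forall>e\<in>E. d e \<cdot>\<^bsub>C\<^esub> p (s e) = p (t e))"

definition is_limit :: "('o, 'm) precategory \<Rightarrow> nat set \<Rightarrow> nat set \<Rightarrow> (nat \<Rightarrow> nat) \<Rightarrow> (nat \<Rightarrow> nat) \<Rightarrow>
    (nat \<Rightarrow> 'o) \<Rightarrow> (nat \<Rightarrow> 'm) \<Rightarrow> 'o \<Rightarrow> (nat \<Rightarrow> 'm) \<Rightarrow> bool" where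
  "is_limit C V E s t D d L p \<longleftrightarrow> is_cone C V E s t D d L p \<and>
    (\<forall>M q. is_cone C V E s t D d M q \<longrightarrow>
      (\<exists>!h. h \<in> Hom C M L \<and> (\<forall>v\<in>V. p v \<cdot>\<^bsub>C\<^esub> h = q v)))"

definition finitely_complete :: "('o, 'm) precategory \<Rightarrow> bool" where
  "finitely_complete C \<longleftrightarrow>
    (\<forall>V E s t D d. finite V \<longrightarrow> finite E \<longrightarrow> is_diagram C V E s t D d \<longrightarrow>
      (\<exists>L p. is_limit C V E s t D d L p))"

definition is_product :: "('o, 'm) precategory \<Rightarrow> 'o \<Rightarrow> 'o \<Rightarrow> 'o \<Rightarrow> 'm \<Rightarrow> 'm \<Rightarrow> bool" where
  "is_product C X Y P p0 p1 \<longleftrightarrow> p0 \<in> Hom C P X \<and> p1 \<in> Hom C P Y \<and>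
    (\<forall>A f g. f \<in> Hom C A X \<longrightarrow> g \<in> Hom C A Y \<longrightarrow>
      (\<exists>!h. h \<in> Hom C A P \<and> p0 \<cdot>\<^bsub>C\<^esub> h = f \<and> p1 \<cdot>\<^bsub>C\<^esub> h = g))"

definition is_pullback :: "('o, 'm) precategory \<Rightarrow> 'm \<Rightarrow> 'm \<Rightarrow> 'o \<Rightarrow> 'm \<Rightarrow> 'm \<Rightarrow> bool" where
  "is_pullback C f g T q0 q1 \<longleftrightarrow> f \<in> Arr C \<and> g \<in> Arr C \<and> Cod C f = Cod C g \<and>
    q0 \<in> Hom C T (Dom C f) \<and> q1 \<in> Hom C T (Dom C g) \<and> f \<cdot>\<^bsub>C\<^esub> q0 = g \<cdot>\<^bsub>C\<^esub> q1 \<and>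
    (\<forall>A u v. u \<in> Hom C A (Dom C f) \<longrightarrow> v \<in> Hom C A (Dom C g) \<longrightarrow> f \<cdot>\<^bsub>C\<^esub> u = g \<cdot>\<^bsub>C\<^esub> v \<longrightarrow>
      (\<exists>!h. h \<in> Hom C A T \<and> q0 \<cdot>\<^bsub>C\<^esub> h = u \<and> q1 \<cdot>\<^bsub>C\<^esub> h = v))"

definition is_coequalizer :: "('o, 'm) precategory \<Rightarrow> 'm \<Rightarrow> 'm \<Rightarrow> 'm \<Rightarrow> bool" where
  "is_coequalizer C f g q \<longleftrightarrow> f \<in> Arr C \<and> g \<in> Arr C \<and> Dom C f = Dom C g \<and> Cod C f = Cod C g \<and>
    q \<in> Arr C \<and> Dom C q = Cod C f \<and> q \<cdot>\<^bsub>C\<^esub> f = q \<cdot>\<^bsub>C\<^esub> g \<and>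
    (\<forall>B h. h \<in> Hom C (Cod C f) B \<longrightarrow> h \<cdot>\<^bsub>C\<^esub> f = h \<cdot>\<^bsub>C\<^esub> g \<longrightarrow>
      (\<exists>!k. k \<in> Hom C (Cod C q) B \<and> k \<cdot>\<^bsub>C\<^esub> q = h))"

definition is_regular_epi :: "('o, 'm) precategory \<Rightarrow> 'm \<Rightarrow> bool" where
  "is_regular_epi C q \<longleftrightarrow> (\<exists>f g. is_coequalizer C f g q)"

locale regular_category = category +
  assumes finite_limits: "finitely_complete C"
    and kernel_pair_coequalizer: "is_pullback C f f K k0 k1 \<Longrightarrow> \<exists>q. is_coequalizer C k0 k1 q"
    and regular_epi_stable: "is_pullback C f g T q0 q1 \<Longrightarrow> is_regular_epi C f \<Longrightarrow> is_regular_epi C q1"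

section \<open>Subobjects\<close>

text \<open>A subobject of \<open>P\<close> is an isomorphism class of monomorphisms into \<open>P\<close>, taken literally as a
  set of arrows; equality of subobjects is therefore equality of sets.\<close>

definition subobject_class :: "('o, 'm) precategory \<Rightarrow> 'm \<Rightarrow> 'm set" where
  "subobject_class C m = {m'. is_mono C m' \<and> Cod C m' = Cod C m \<and>
    (\<exists>i \<in> Hom C (Dom C m') (Dom C m). is_iso C i \<and> m' = m \<cdot>\<^bsub>C\<^esub> i)}"

definition is_subobject :: "('o, 'm) precategory \<Rightarrow> 'o \<Rightarrow> 'm set \<Rightarrow> bool" where
  "is_subobject C P A \<longleftrightarrow> (\<exists>m. is_mono C m \<and> Cod C m = P \<and> A = subobject_class C m)"

definition subobject_le :: "('o, 'm) precategory \<Rightarrow> 'm set \<Rightarrow> 'm set \<Rightarrow> bool" where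
  "subobject_le C A B \<longleftrightarrow> (\<exists>a\<in>A. \<exists>b\<in>B. \<exists>h \<in> Hom C (Dom C a) (Dom C b). a = b \<cdot>\<^bsub>C\<^esub> h)"

section \<open>Relations\<close>

text \<open>Below, \<open>(P, p0, p1)\<close> is a product of \<open>X\<close> with itself, so that relations on \<open>X\<close> are the
  subobjects of \<open>P\<close>.\<close>

definition pairing :: "('o, 'm) precategory \<Rightarrow> 'o \<Rightarrow> 'm \<Rightarrow> 'm \<Rightarrow> 'm \<Rightarrow> 'm \<Rightarrow> 'm" where
  "pairing C P p0 p1 f g =
    (THE h. h \<in> Hom C (Dom C f) P \<and> p0 \<cdot>\<^bsub>C\<^esub> h = f \<and> p1 \<cdot>\<^bsub>C\<^esub> h = g)"

definition diagonal :: "('o, 'm) precategory \<Rightarrow> 'o \<Rightarrow> 'o \<Rightarrow> 'm \<Rightarrow> 'm \<Rightarrow> 'm set" where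
  "diagonal C X P p0 p1 = subobject_class C (pairing C P p0 p1 (Ident C X) (Ident C X))"

text \<open>The composite \<open>S \<circ> R\<close> (first \<open>R\<close>, then \<open>S\<close>), also written \<open>SR\<close>: it consists of the monic parts
  of all regular epi-mono factorizations of the arrow \<open>T \<rightarrow> P\<close> induced on the pullback \<open>T\<close> of the
  second leg of \<open>R\<close> along the first leg of \<open>S\<close>. All choices of representatives, pullbacks and
  factorizations are included, which makes up exactly one isomorphism class.\<close>

definition rel_comp :: "('o, 'm) precategory \<Rightarrow> 'o \<Rightarrow> 'm \<Rightarrow> 'm \<Rightarrow> 'm set \<Rightarrow> 'm set \<Rightarrow> 'm set" where
  "rel_comp C P p0 p1 S R = {m. is_mono C m \<and> Cod C m = P \<and>
    (\<exists>r\<in>R. \<exists>s\<in>S. \<exists>T q0 q1. is_pullback C (p1 \<cdot>\<^bsub>C\<^esub> r) (p0 \<cdot>\<^bsub>C\<^esub> s) T q0 q1 \<and>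
      (\<exists>e \<in> Hom C T (Dom C m). is_regular_epi C e \<and>
        pairing C P p0 p1 ((p0 \<cdot>\<^bsub>C\<^esub> r) \<cdot>\<^bsub>C\<^esub> q0) ((p1 \<cdot>\<^bsub>C\<^esub> s) \<cdot>\<^bsub>C\<^esub> q1) = m \<cdot>\<^bsub>C\<^esub> e))}"

definition reflexive_relation :: "('o, 'm) precategory \<Rightarrow> 'o \<Rightarrow> 'o \<Rightarrow> 'm \<Rightarrow> 'm \<Rightarrow> 'm set \<Rightarrow> bool" where
  "reflexive_relation C X P p0 p1 R \<longleftrightarrow>
    is_subobject C P R \<and> subobject_le C (diagonal C X P p0 p1) R"

definition transitive_relation :: "('o, 'm) precategory \<Rightarrow> 'o \<Rightarrow> 'm \<Rightarrow> 'm \<Rightarrow> 'm set \<Rightarrow> bool" where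
  "transitive_relation C P p0 p1 R \<longleftrightarrow>
    is_subobject C P R \<and> subobject_le C (rel_comp C P p0 p1 R R) R"

definition preorder_relation :: "('o, 'm) precategory \<Rightarrow> 'o \<Rightarrow> 'o \<Rightarrow> 'm \<Rightarrow> 'm \<Rightarrow> 'm set \<Rightarrow> bool" where
  "preorder_relation C X P p0 p1 R \<longleftrightarrow>
    reflexive_relation C X P p0 p1 R \<and> transitive_relation C P p0 p1 R"

text \<open>\<open>alt_prod C X P p0 p1 R S n\<close> is \<open>(R,S)\<^sub>n\<close>. The factor appended on the right at index \<open>n + 2\<close> is
  \<open>S\<close> for even \<open>n\<close> and \<open>R\<close> for odd \<open>n\<close>.\<close>

fun alt_prod :: "('o, 'm) precategory \<Rightarrow> 'o \<Rightarrow> 'o \<Rightarrow> 'm \<Rightarrow> 'm \<Rightarrow> 'm set \<Rightarrow> 'm set \<Rightarrow> nat \<Rightarrow> 'm set" where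
  "alt_prod C X P p0 p1 R S 0 = diagonal C X P p0 p1"
| "alt_prod C X P p0 p1 R S (Suc 0) = R"
| "alt_prod C X P p0 p1 R S (Suc (Suc n)) =
    rel_comp C P p0 p1 (alt_prod C X P p0 p1 R S (Suc n)) (if even n then S else R)"

end

theory Submission
  imports Defs
begin

text \<open>
  Write \<open>W\<^sub>n\<close> for \<open>(R,S)\<^sub>n\<close>. All three conditions say that \<open>W\<^sub>n\<close> absorbs both \<open>R\<close> and \<open>S\<close>, that is,
  \<open>W\<^sub>n R = W\<^sub>n = W\<^sub>n S\<close>. As the relations are reflexive, the chain is increasing; so
  \<open>W\<^sub>n\<^sub>+\<^sub>2 = W\<^sub>n\<close> forces \<open>W\<^sub>n\<^sub>+\<^sub>1 = W\<^sub>n\<close>, and the two steps from \<open>n\<close> to \<open>n + 2\<close> append one factor \<open>R\<close>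
  and one factor \<open>S\<close>. Absorption makes the chain stationary, and since \<open>W\<^sub>n\<close> is itself a product of
  factors \<open>R\<close> and \<open>S\<close>, associativity then gives \<open>W\<^sub>n W\<^sub>n \<subseteq> W\<^sub>n\<close>. Conversely, for \<open>n \<ge> 2\<close> the relation
  \<open>W\<^sub>n\<close> contains \<open>R\<close> and \<open>S\<close>, so transitivity gives \<open>W\<^sub>n R \<subseteq> W\<^sub>n W\<^sub>n \<subseteq> W\<^sub>n\<close>, and likewise for \<open>S\<close>.

  The calculus of relations behind this (composites are subobjects, associativity, monotonicity) is
  obtained by reasoning with generalized elements. A pair of arrows \<open>x, y : A \<rightarrow> X\<close> belongs to the
  composite \<open>S \<circ> R\<close> if and only if, after passing to a cover \<open>c : B \<rightarrow> A\<close>, there is \<open>z : B \<rightarrow> X\<close> with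
  \<open>(x c, z)\<close> in \<open>R\<close> and \<open>(z, y c)\<close> in \<open>S\<close> (lemma \<open>holds_rel_comp\<close>). A subobject is determined by its
  generalized elements, so that the calculus reduces to pointwise arguments. Covers are the arrows
  orthogonal to monomorphisms; they contain the regular epimorphisms and, by their very definition,
  are closed under composition.
\<close>

section \<open>Arrows, monomorphisms and covers\<close>

context category
begin

lemma Hom_iff: "f \<in> Hom C A B \<longleftrightarrow> f \<in> Arr C \<and> Dom C f = A \<and> Cod C f = B"
  by (simp add: Hom_def)

lemma comp_arr [simp]:
  assumes "f \<in> Arr C" "g \<in> Arr C" "Dom C g = Cod C f"
  shows "g \<cdot> f \<in> Arr C" "Dom C (g \<cdot> f) = Dom C f" "Cod C (g \<cdot> f) = Cod C g"
  using comp_hom[of f "Dom C f" "Cod C f" g "Cod C g"] assms by (auto simp: Hom_iff)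

lemma comp_assoc_arr:
  assumes "f \<in> Arr C" "g \<in> Arr C" "h \<in> Arr C" "Dom C g = Cod C f" "Dom C h = Cod C g"
  shows "(h \<cdot> g) \<cdot> f = h \<cdot> (g \<cdot> f)"
  using comp_assoc[of f "Dom C f" "Cod C f" g "Cod C g" h "Cod C h"] assms by (auto simp: Hom_iff)

lemma ident_arr [simp]:
  assumes "A \<in> Obj C"
  shows "Ident C A \<in> Arr C" "Dom C (Ident C A) = A" "Cod C (Ident C A) = A"
  using ident_hom[OF assms] by (auto simp: Hom_iff)

lemma ident_comp [simp]:
  assumes "f \<in> Arr C"
  shows "Cod C f = A \<Longrightarrow> Ident C A \<cdot> f = f" "Dom C f = A \<Longrightarrow> f \<cdot> Ident C A = f"
  using assms ident_left ident_right by (auto simp: Hom_iff)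

lemma mono_arr: "is_mono C m \<Longrightarrow> m \<in> Arr C"
  by (simp add: is_mono_def)

lemma mono_cancel:
  assumes "is_mono C m" "m \<cdot> f = m \<cdot> g" "f \<in> Arr C" "g \<in> Arr C"
    "Cod C f = Dom C m" "Cod C g = Dom C m" "Dom C f = Dom C g"
  shows "f = g"
  using assms unfolding is_mono_def Hom_iff by metis

definition factors :: "'m \<Rightarrow> 'm \<Rightarrow> bool" where
  "factors f m \<longleftrightarrow> (\<exists>h \<in> Hom C (Dom C f) (Dom C m). f = m \<cdot> h)"

lemma factors_iff:
  "factors f m \<longleftrightarrow> (\<exists>h \<in> Arr C. Dom C h = Dom C f \<and> Cod C h = Dom C m \<and> f = m \<cdot> h)"
  unfolding factors_def by (auto simp: Hom_iff)

lemma factors_refl: "f \<in> Arr C \<Longrightarrow> factors f f"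
  unfolding factors_iff by (metis dom_obj ident_arr ident_comp(2))

lemma factors_trans:
  assumes "factors f g" "factors g h" "h \<in> Arr C"
  shows "factors f h"
proof -
  obtain i j where i: "i \<in> Hom C (Dom C f) (Dom C g)" "f = g \<cdot> i"
    and j: "j \<in> Hom C (Dom C g) (Dom C h)" "g = h \<cdot> j"
    using assms unfolding factors_def by blast
  have "(h \<cdot> j) \<cdot> i = h \<cdot> (j \<cdot> i)"
    using i(1) j(1) assms(3) by (simp add: Hom_iff comp_assoc_arr)
  then have "f = h \<cdot> (j \<cdot> i)"
    using i(2) j(2) by simp
  moreover have "j \<cdot> i \<in> Hom C (Dom C f) (Dom C h)"
    using comp_hom i(1) j(1) .
  ultimately show ?thesis
    unfolding factors_def by blast
qed

lemma factors_precomp: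
  assumes "factors f m" "c \<in> Arr C" "Cod C c = Dom C f" "m \<in> Arr C"
  shows "factors (f \<cdot> c) m"
proof -
  obtain h where h: "h \<in> Hom C (Dom C f) (Dom C m)" "f = m \<cdot> h"
    using assms unfolding factors_def by blast
  have ha: "h \<in> Arr C" "Dom C h = Dom C f" "Cod C h = Dom C m"
    using h(1) by (auto simp: Hom_iff)
  have "h \<cdot> c \<in> Hom C (Dom C ((m \<cdot> h) \<cdot> c)) (Dom C m)" "(m \<cdot> h) \<cdot> c = m \<cdot> (h \<cdot> c)"
    using ha assms(2-4) by (simp_all add: Hom_iff comp_assoc_arr)
  then show ?thesis
    unfolding h(2)[symmetric]
    unfolding factors_def by blast
qed

text \<open>A cover is an arrow along which membership in a subobject is local: a generalized element that
  lands in the subobject after restriction along the cover was there already.\<close>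

definition cover :: "'m \<Rightarrow> bool" where
  "cover c \<longleftrightarrow> c \<in> Arr C \<and>
    (\<forall>m f. is_mono C m \<longrightarrow> f \<in> Hom C (Cod C c) (Cod C m) \<longrightarrow> factors (f \<cdot> c) m \<longrightarrow> factors f m)"

lemma cover_arr: "cover c \<Longrightarrow> c \<in> Arr C"
  by (simp add: cover_def)

lemma cover_local:
  assumes "cover c" "factors (f \<cdot> c) m" "is_mono C m"
    "f \<in> Arr C" "Dom C f = Cod C c" "Cod C f = Cod C m"
  shows "factors f m"
  using assms unfolding cover_def Hom_iff by blast

lemma cover_ident: "A \<in> Obj C \<Longrightarrow> cover (Ident C A)"
  unfolding cover_def Hom_iff by auto

lemma cover_comp:
  assumes "cover c" "cover d" "Cod C d = Dom C c"
  shows "cover (c \<cdot> d)"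
  unfolding cover_def
proof (intro conjI allI impI)
  have arr: "c \<in> Arr C" "d \<in> Arr C"
    using assms cover_arr by auto
  then show "c \<cdot> d \<in> Arr C"
    using assms(3) by simp
  fix m f
  assume m: "is_mono C m" and f: "f \<in> Hom C (Cod C (c \<cdot> d)) (Cod C m)"
    and fac: "factors (f \<cdot> (c \<cdot> d)) m"
  from f arr assms(3) have f': "f \<in> Arr C" "Dom C f = Cod C c" "Cod C f = Cod C m"
    by (auto simp: Hom_iff)
  have "factors ((f \<cdot> c) \<cdot> d) m"
    using fac f' arr assms(3) by (simp add: comp_assoc_arr)
  then have "factors (f \<cdot> c) m"
    using cover_local[OF assms(2) _ m] f' arr assms(3) by simp
  then show "factors f m"
    using cover_local[OF assms(1) _ m] f' by simp
qed

lemma regular_epi_arr: "is_regular_epi C e \<Longrightarrow> e \<in> Arr C"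
  unfolding is_regular_epi_def is_coequalizer_def by blast

lemma regular_epi_cancel:
  assumes "is_regular_epi C e" "f \<cdot> e = g \<cdot> e" "f \<in> Arr C" "g \<in> Arr C"
    "Dom C f = Cod C e" "Dom C g = Cod C e" "Cod C f = Cod C g"
  shows "f = g"
proof -
  obtain a b where "is_coequalizer C a b e"
    using assms(1) unfolding is_regular_epi_def by blast
  then have ab: "a \<in> Arr C" "b \<in> Arr C" "Dom C a = Dom C b" "Cod C a = Cod C b"
      "e \<in> Arr C" "Dom C e = Cod C a" "e \<cdot> a = e \<cdot> b"
    and uniq: "\<And>B h. h \<in> Hom C (Cod C a) B \<Longrightarrow> h \<cdot> a = h \<cdot> b \<Longrightarrow>
      \<exists>!k. k \<in> Hom C (Cod C e) B \<and> k \<cdot> e = h"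
    unfolding is_coequalizer_def by auto
  have "f \<cdot> e \<in> Hom C (Cod C a) (Cod C f)" "(f \<cdot> e) \<cdot> a = (f \<cdot> e) \<cdot> b"
    using ab assms by (auto simp: Hom_iff comp_assoc_arr)
  from uniq[OF this] show ?thesis
    using assms by (auto simp: Hom_iff)
qed

text \<open>If \<open>f e = m u\<close> with \<open>e\<close> a coequalizer and \<open>m\<close> monic, then \<open>u\<close> coequalizes the same pair as \<open>e\<close>
  and therefore descends along \<open>e\<close>.\<close>

lemma regular_epi_cover:
  assumes "is_regular_epi C e"
  shows "cover e"
  unfolding cover_def
proof (intro conjI allI impI)
  obtain a b where "is_coequalizer C a b e"
    using assms unfolding is_regular_epi_def by blast
  then have ab: "a \<in> Arr C" "b \<in> Arr C" "Dom C a = Dom C b" "Cod C a = Cod C b"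
      "e \<in> Arr C" "Dom C e = Cod C a" "e \<cdot> a = e \<cdot> b"
    and univ: "\<And>B h. h \<in> Hom C (Cod C a) B \<Longrightarrow> h \<cdot> a = h \<cdot> b \<Longrightarrow>
      \<exists>!k. k \<in> Hom C (Cod C e) B \<and> k \<cdot> e = h"
    unfolding is_coequalizer_def by auto
  then show "e \<in> Arr C" by simp
  fix m f
  assume m: "is_mono C m" and f: "f \<in> Hom C (Cod C e) (Cod C m)" and fac: "factors (f \<cdot> e) m"
  from f have f': "f \<in> Arr C" "Dom C f = Cod C e" "Cod C f = Cod C m"
    by (auto simp: Hom_iff)
  obtain u where u: "u \<in> Arr C" "Dom C u = Dom C e" "Cod C u = Dom C m" "f \<cdot> e = m \<cdot> u"
    using fac f' ab unfolding factors_iff by auto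
  have "m \<cdot> (u \<cdot> a) = (f \<cdot> e) \<cdot> a"
    using u ab m by (simp add: comp_assoc_arr mono_arr)
  also have "\<dots> = (f \<cdot> e) \<cdot> b"
    using f' ab by (simp add: comp_assoc_arr)
  also have "\<dots> = m \<cdot> (u \<cdot> b)"
    using u ab m by (simp add: comp_assoc_arr mono_arr)
  finally have "u \<cdot> a = u \<cdot> b"
    by (rule mono_cancel[OF m]) (use u ab in auto)
  then obtain k where k: "k \<in> Arr C" "Dom C k = Cod C e" "Cod C k = Dom C m" "k \<cdot> e = u"
    using univ[of u "Dom C m"] u ab by (auto simp: Hom_iff)
  have "(m \<cdot> k) \<cdot> e = f \<cdot> e"
    using k u ab m by (simp add: comp_assoc_arr mono_arr)
  then have "m \<cdot> k = f"
    by (rule regular_epi_cancel[OF assms]) (use k f' m in \<open>auto simp: mono_arr\<close>)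
  then show "factors f m"
    using k f' unfolding factors_iff by auto
qed

lemma regular_epi_postcomp_iso:
  assumes "is_regular_epi C e" "i \<in> Hom C (Cod C e) A" "j \<in> Hom C A (Cod C e)"
    and ji: "j \<cdot> i = Ident C (Cod C e)" and ij: "i \<cdot> j = Ident C A"
  shows "is_regular_epi C (i \<cdot> e)"
proof -
  obtain a b where coeq: "is_coequalizer C a b e"
    using assms(1) unfolding is_regular_epi_def by blast
  then have ab: "a \<in> Arr C" "b \<in> Arr C" "Dom C a = Dom C b" "Cod C a = Cod C b"
      "e \<in> Arr C" "Dom C e = Cod C a" "e \<cdot> a = e \<cdot> b"
    and univ: "\<And>B h. h \<in> Hom C (Cod C a) B \<Longrightarrow> h \<cdot> a = h \<cdot> b \<Longrightarrow>
      \<exists>!k. k \<in> Hom C (Cod C e) B \<and> k \<cdot> e = h"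
    unfolding is_coequalizer_def by auto
  have i: "i \<in> Arr C" "Dom C i = Cod C e" "Cod C i = A"
    and j: "j \<in> Arr C" "Dom C j = A" "Cod C j = Cod C e"
    using assms(2,3) by (auto simp: Hom_iff)
  have "\<exists>!k. k \<in> Hom C (Cod C (i \<cdot> e)) B \<and> k \<cdot> (i \<cdot> e) = h"
    if h: "h \<in> Hom C (Cod C a) B" "h \<cdot> a = h \<cdot> b" for B h
  proof -
    obtain k where k: "k \<in> Hom C (Cod C e) B" "k \<cdot> e = h"
      using univ[OF h] by blast
    have "(k \<cdot> j) \<cdot> (i \<cdot> e) = k \<cdot> ((j \<cdot> i) \<cdot> e)"
      using k i j ab by (simp add: Hom_iff comp_assoc_arr del: ident_comp)
    then have ex: "k \<cdot> j \<in> Hom C (Cod C (i \<cdot> e)) B \<and> (k \<cdot> j) \<cdot> (i \<cdot> e) = h"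
      using k i j ab by (simp add: Hom_iff ji)
    have "k' = k \<cdot> j" if k': "k' \<in> Hom C (Cod C (i \<cdot> e)) B" "k' \<cdot> (i \<cdot> e) = h" for k'
    proof -
      have k'a: "k' \<in> Arr C" "Dom C k' = A" "Cod C k' = B"
        using k' i ab by (auto simp: Hom_iff)
      have "(k' \<cdot> i) \<cdot> e = k \<cdot> e"
        using k k' k'a i ab by (simp add: comp_assoc_arr)
      then have "k' \<cdot> i = k"
        by (rule regular_epi_cancel[OF assms(1)]) (use k k'a i ab in \<open>auto simp: Hom_iff\<close>)
      then have "k \<cdot> j = k' \<cdot> (i \<cdot> j)"
        using k'a i j by (auto simp: comp_assoc_arr)
      then show ?thesis
        using k'a by (simp add: ij)
    qed
    with ex show ?thesis by blast
  qed
  then have "is_coequalizer C a b (i \<cdot> e)"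
    using ab i unfolding is_coequalizer_def by (simp add: comp_assoc_arr)
  then show ?thesis
    unfolding is_regular_epi_def by blast
qed

end

section \<open>Subobjects\<close>

context category
begin

text \<open>Two monomorphisms that factor through each other differ by an isomorphism, so that a subobject
  can be handled through factorizations alone.\<close>

lemma mutual_factors_iso:
  assumes "is_mono C m" "is_mono C m'" "factors m m'" "factors m' m"
  obtains i j where "i \<in> Hom C (Dom C m') (Dom C m)" "j \<in> Hom C (Dom C m) (Dom C m')"
    "m' = m \<cdot> i" "m = m' \<cdot> j" "j \<cdot> i = Ident C (Dom C m')" "i \<cdot> j = Ident C (Dom C m)"
proof -
  obtain i j where ij: "i \<in> Hom C (Dom C m') (Dom C m)" "m' = m \<cdot> i"
    "j \<in> Hom C (Dom C m) (Dom C m')" "m = m' \<cdot> j"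
    using assms(3,4) unfolding factors_def by blast
  have ms: "m \<in> Arr C" "m' \<in> Arr C" "Dom C m \<in> Obj C" "Dom C m' \<in> Obj C"
    using assms mono_arr dom_obj by auto
  have "m' \<cdot> (j \<cdot> i) = (m' \<cdot> j) \<cdot> i"
    using ms(1,2) ij(1,3) by (simp add: Hom_iff comp_assoc_arr)
  also have "\<dots> = m' \<cdot> Ident C (Dom C m')"
    unfolding ij(4)[symmetric] ij(2)[symmetric] using ms by simp
  finally have 1: "j \<cdot> i = Ident C (Dom C m')"
    by (rule mono_cancel[OF assms(2)]) (use ms ij(1,3) in \<open>auto simp: Hom_iff\<close>)
  have "m \<cdot> (i \<cdot> j) = (m \<cdot> i) \<cdot> j"
    using ms(1,2) ij(1,3) by (simp add: Hom_iff comp_assoc_arr)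
  also have "\<dots> = m \<cdot> Ident C (Dom C m)"
    unfolding ij(2)[symmetric] ij(4)[symmetric] using ms by simp
  finally have 2: "i \<cdot> j = Ident C (Dom C m)"
    by (rule mono_cancel[OF assms(1)]) (use ms ij(1,3) in \<open>auto simp: Hom_iff\<close>)
  show ?thesis
    by (rule that[OF ij(1,3,2,4) 1 2])
qed

lemma in_subobject_class_iff:
  assumes "is_mono C m"
  shows "m' \<in> subobject_class C m \<longleftrightarrow>
    is_mono C m' \<and> Cod C m' = Cod C m \<and> factors m m' \<and> factors m' m"
proof
  assume "m' \<in> subobject_class C m"
  then obtain i where m': "is_mono C m'" "Cod C m' = Cod C m"
    and i: "i \<in> Hom C (Dom C m') (Dom C m)" "is_iso C i" "m' = m \<cdot> i"
    unfolding subobject_class_def by blast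
  have "Dom C i = Dom C m'" "Cod C i = Dom C m"
    using i(1) by (simp_all add: Hom_iff)
  then obtain j where j: "j \<in> Hom C (Dom C m) (Dom C m')" "i \<cdot> j = Ident C (Dom C m)"
    using i(2) unfolding is_iso_def by auto
  have "m = m \<cdot> (i \<cdot> j)"
    using assms mono_arr j by simp
  also have "\<dots> = m' \<cdot> j"
    unfolding i(3) using i(1) j(1) assms by (simp add: Hom_iff comp_assoc_arr mono_arr)
  finally show "is_mono C m' \<and> Cod C m' = Cod C m \<and> factors m m' \<and> factors m' m"
    using m' i j(1) unfolding factors_def by blast
next
  assume R: "is_mono C m' \<and> Cod C m' = Cod C m \<and> factors m m' \<and> factors m' m"
  obtain i j where ij: "i \<in> Hom C (Dom C m') (Dom C m)" "j \<in> Hom C (Dom C m) (Dom C m')"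
    "m' = m \<cdot> i" "j \<cdot> i = Ident C (Dom C m')" "i \<cdot> j = Ident C (Dom C m)"
    using mutual_factors_iso[OF assms] R by metis
  then have "is_iso C i"
    unfolding is_iso_def by (auto simp: Hom_iff)
  then show "m' \<in> subobject_class C m"
    using R ij unfolding subobject_class_def by blast
qed

lemma subobject_class_self: "is_mono C m \<Longrightarrow> m \<in> subobject_class C m"
  by (simp add: in_subobject_class_iff factors_refl mono_arr)

lemma subobject_member:
  assumes "is_subobject C Q A" "a \<in> A"
  shows "is_mono C a" "a \<in> Arr C" "Cod C a = Q" "A = subobject_class C a"
proof -
  obtain m where m: "is_mono C m" "Cod C m = Q" "A = subobject_class C m"
    using assms(1) unfolding is_subobject_def by blast
  have a: "is_mono C a" "Cod C a = Cod C m" "factors m a" "factors a m"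
    using assms(2) m in_subobject_class_iff by auto
  then show "is_mono C a" "a \<in> Arr C" "Cod C a = Q"
    using m mono_arr by auto
  have "b \<in> subobject_class C a \<longleftrightarrow> b \<in> subobject_class C m" for b
    unfolding in_subobject_class_iff[OF a(1)] in_subobject_class_iff[OF m(1)]
    using a m(1) factors_trans mono_arr by metis
  then show "A = subobject_class C a"
    using m(3) by blast
qed

lemma subobject_nonempty:
  assumes "is_subobject C Q A"
  obtains a where "a \<in> A"
  using assms subobject_class_self unfolding is_subobject_def by blast

lemma subobject_factors:
  assumes "is_subobject C Q A" "a \<in> A" "b \<in> A"
  shows "factors a b"
  using subobject_member[OF assms(1,2)] assms(3) in_subobject_class_iff by blast

lemma subobject_eqI:
  assumes A: "is_subobject C Q A" "a \<in> A" and B: "is_subobject C Q B" "b \<in> B"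
    and "factors a b" "factors b a"
  shows "A = B"
proof -
  have "b \<in> A"
    using subobject_member[OF A] subobject_member[OF B] assms(5,6) in_subobject_class_iff by auto
  then show ?thesis
    using subobject_member(4)[OF A(1)] subobject_member(4)[OF B] by blast
qed

end

section \<open>Image factorizations\<close>

context regular_category
begin

lemma pullback_exists:
  assumes "f \<in> Arr C" "g \<in> Arr C" "Cod C f = Cod C g"
  obtains T q0 q1 where "is_pullback C f g T q0 q1"
proof -
  \<comment> \<open>A pullback is a limit of the cospan with vertices \<open>0, 1\<close> over \<open>2\<close>.\<close>
  define D where "D = (\<lambda>v::nat. if v = 0 then Dom C f else if v = 1 then Dom C g else Cod C f)"
  define d where "d = (\<lambda>e::nat. if e = 0 then f else g)"
  let ?lim = "is_limit C {0,1,2} {0,1} id (\<lambda>_. 2) D d"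
  let ?cone = "is_cone C {0,1,2} {0,1} id (\<lambda>_. 2) D d"
  have "is_diagram C {0,1,2} {0,1} id (\<lambda>_. 2) D d"
    using assms dom_obj cod_obj unfolding is_diagram_def D_def d_def by (auto simp: Hom_iff)
  then obtain L p where L: "?lim L p"
    using finite_limits unfolding finitely_complete_def by (metis finite.emptyI finite.insertI)
  have cone: "?cone L p" and
    univ: "\<And>M q. ?cone M q \<Longrightarrow> \<exists>!h. h \<in> Hom C M L \<and> (\<forall>v\<in>{0,1,2}. p v \<cdot> h = q v)"
    using L unfolding is_limit_def by auto
  from cone have p: "L \<in> Obj C" "p 0 \<in> Hom C L (Dom C f)" "p 1 \<in> Hom C L (Dom C g)"
    "f \<cdot> p 0 = p 2" "g \<cdot> p 1 = p 2"
    unfolding is_cone_def D_def d_def by auto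
  have "\<exists>!h. h \<in> Hom C A L \<and> p 0 \<cdot> h = u \<and> p 1 \<cdot> h = v"
    if uv: "u \<in> Hom C A (Dom C f)" "v \<in> Hom C A (Dom C g)" "f \<cdot> u = g \<cdot> v" for A u v
  proof -
    define q where "q = (\<lambda>i::nat. if i = 0 then u else if i = 1 then v else f \<cdot> u)"
    have "?cone A q"
      using uv assms dom_obj unfolding is_cone_def D_def d_def q_def by (auto simp: Hom_iff)
    from univ[OF this] have
      ex1: "\<exists>!h. h \<in> Hom C A L \<and> p 0 \<cdot> h = u \<and> p 1 \<cdot> h = v \<and> p 2 \<cdot> h = f \<cdot> u"
      unfolding q_def by simp
    have "p 2 \<cdot> h = f \<cdot> u" if "h \<in> Hom C A L" "p 0 \<cdot> h = u" for h
      using p(2) that assms unfolding p(4)[symmetric] by (simp add: Hom_iff comp_assoc_arr)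
    with ex1 show ?thesis by metis
  qed
  then have "is_pullback C f g L (p 0) (p 1)"
    unfolding is_pullback_def using assms p by auto
  then show ?thesis
    by (rule that)
qed

lemma pullback_factor:
  assumes "is_pullback C f g T q0 q1" "u \<in> Hom C A (Dom C f)" "v \<in> Hom C A (Dom C g)"
    "f \<cdot> u = g \<cdot> v"
  obtains t where "t \<in> Hom C A T" "q0 \<cdot> t = u" "q1 \<cdot> t = v"
  using assms unfolding is_pullback_def by metis

lemma pullback_arr:
  assumes "is_pullback C f g T q0 q1"
  shows "q0 \<in> Arr C" "q1 \<in> Arr C" "Dom C q0 = T" "Dom C q1 = T"
    "Cod C q0 = Dom C f" "Cod C q1 = Dom C g" "f \<cdot> q0 = g \<cdot> q1"
  using assms unfolding is_pullback_def Hom_iff by auto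

text \<open>Regular epimorphisms are surjective on generalized elements, up to a regular epimorphism.\<close>

lemma regular_epi_lift:
  assumes "is_regular_epi C e" "u \<in> Arr C" "Cod C u = Cod C e"
  obtains c t where "is_regular_epi C c" "Cod C c = Dom C u" "t \<in> Hom C (Dom C c) (Dom C e)"
    "u \<cdot> c = e \<cdot> t"
proof -
  have e: "e \<in> Arr C"
    using assms(1) regular_epi_arr by blast
  obtain T q0 q1 where pb: "is_pullback C e u T q0 q1"
    using pullback_exists[OF e assms(2)] assms(3) by metis
  note q = pullback_arr[OF pb]
  show ?thesis
    by (rule that[OF regular_epi_stable[OF pb assms(1)], of q0]) (use q in \<open>auto simp: Hom_iff\<close>)
qed

text \<open>Dividing \<open>f\<close> by its kernel pair leaves a monomorphism: two generalized elements of the quotient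
  lift, over a common cover, to elements of the domain of \<open>f\<close>; when they have the same image under
  \<open>f\<close>, they are related by the kernel pair and so were equal already.\<close>

lemma image_factorization:
  assumes f: "f \<in> Arr C"
  obtains m e where "is_mono C m" "is_regular_epi C e" "Cod C e = Dom C m" "f = m \<cdot> e"
proof -
  obtain K k0 k1 where pb: "is_pullback C f f K k0 k1"
    using pullback_exists[OF f f] by blast
  note k = pullback_arr[OF pb]
  obtain e where coeq: "is_coequalizer C k0 k1 e"
    using kernel_pair_coequalizer[OF pb] by blast
  have e: "e \<in> Arr C" "Dom C e = Dom C f" "e \<cdot> k0 = e \<cdot> k1"
    using coeq k unfolding is_coequalizer_def by auto
  have reg: "is_regular_epi C e"
    using coeq unfolding is_regular_epi_def by blast
  obtain m where m: "m \<in> Arr C" "Dom C m = Cod C e" "Cod C m = Cod C f" "m \<cdot> e = f"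
    using coeq k f unfolding is_coequalizer_def Hom_iff by metis
  have "u = v" if uv: "u \<in> Hom C A (Dom C m)" "v \<in> Hom C A (Dom C m)" "m \<cdot> u = m \<cdot> v" for A u v
  proof -
    have u: "u \<in> Arr C" "Dom C u = A" "Cod C u = Cod C e"
      and v: "v \<in> Arr C" "Dom C v = A" "Cod C v = Cod C e"
      using uv m by (auto simp: Hom_iff)
    obtain c s where c: "is_regular_epi C c" "Cod C c = A"
      and s: "s \<in> Arr C" "Dom C s = Dom C c" "Cod C s = Dom C e" "u \<cdot> c = e \<cdot> s"
      using regular_epi_lift[OF reg u(1,3)] u unfolding Hom_iff by metis
    note ca = regular_epi_arr[OF c(1)]
    have vc: "v \<cdot> c \<in> Arr C" "Cod C (v \<cdot> c) = Cod C e" "Dom C (v \<cdot> c) = Dom C c"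
      using v c ca by auto
    obtain d t where d: "is_regular_epi C d" "Cod C d = Dom C c"
      and t: "t \<in> Arr C" "Dom C t = Dom C d" "Cod C t = Dom C e" "(v \<cdot> c) \<cdot> d = e \<cdot> t"
      using regular_epi_lift[OF reg vc(1,2)] vc unfolding Hom_iff by metis
    note da = regular_epi_arr[OF d(1)]
    have ucd: "(u \<cdot> c) \<cdot> d = e \<cdot> (s \<cdot> d)"
      using s d da e by (simp add: comp_assoc_arr)
    have "f \<cdot> (s \<cdot> d) = m \<cdot> ((u \<cdot> c) \<cdot> d)"
      unfolding ucd m(4)[symmetric] using s(1-3) d da e m(1-3) by (simp add: comp_assoc_arr)
    also have "\<dots> = ((m \<cdot> u) \<cdot> c) \<cdot> d"
      using u c ca d da m by (simp add: comp_assoc_arr)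
    also have "\<dots> = m \<cdot> ((v \<cdot> c) \<cdot> d)"
      unfolding uv(3) using v c ca d da m by (simp add: comp_assoc_arr)
    also have "\<dots> = f \<cdot> t"
      unfolding t(4) m(4)[symmetric] using t(1-3) e m(1-3) by (simp add: comp_assoc_arr)
    finally have "f \<cdot> (s \<cdot> d) = f \<cdot> t" .
    then obtain w where w: "w \<in> Hom C (Dom C d) K" "k0 \<cdot> w = s \<cdot> d" "k1 \<cdot> w = t"
      using pullback_factor[OF pb, of "s \<cdot> d" "Dom C d" t] s d da t e by (auto simp: Hom_iff)
    have "(u \<cdot> c) \<cdot> d = (e \<cdot> k0) \<cdot> w"
      unfolding ucd w(2)[symmetric] using w(1) e(1,2) k by (simp add: Hom_iff comp_assoc_arr)
    also have "\<dots> = e \<cdot> (k1 \<cdot> w)"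
      unfolding e(3) using w(1) e(1,2) k by (simp add: Hom_iff comp_assoc_arr)
    also have "\<dots> = (v \<cdot> c) \<cdot> d"
      unfolding w(3) t(4) ..
    finally have "u \<cdot> c = v \<cdot> c"
      by (rule regular_epi_cancel[OF d(1)]) (use u v c ca d in auto)
    then show "u = v"
      by (rule regular_epi_cancel[OF c(1)]) (use u v c in auto)
  qed
  then have "is_mono C m"
    using m(1) unfolding is_mono_def by blast
  then show ?thesis
    using that reg m by metis
qed

end

section \<open>Relations and their generalized elements\<close>

locale relations_on = regular_category C for C :: "('o, 'm) precategory" (structure) +
  fixes X P :: 'o and p0 p1 :: 'm
  assumes base_obj: "X \<in> Obj C"
    and product: "is_product C X X P p0 p1"
begin

abbreviation is_rel :: "'m set \<Rightarrow> bool" where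
  "is_rel \<equiv> is_subobject C P"

abbreviation composite :: "'m set \<Rightarrow> 'm set \<Rightarrow> 'm set" (infixr "\<odot>" 65) where
  "S \<odot> R \<equiv> rel_comp C P p0 p1 S R"

lemma proj_arr [simp]:
  "p0 \<in> Arr C" "Dom C p0 = P" "Cod C p0 = X" "p1 \<in> Arr C" "Dom C p1 = P" "Cod C p1 = X"
  using product unfolding is_product_def by (auto simp: Hom_iff)

lemma product_ext:
  assumes "f \<in> Arr C" "g \<in> Arr C" "Dom C f = Dom C g" "Cod C f = P" "Cod C g = P"
    "p0 \<cdot> f = p0 \<cdot> g" "p1 \<cdot> f = p1 \<cdot> g"
  shows "f = g"
proof -
  have "p0 \<cdot> f \<in> Hom C (Dom C f) X" "p1 \<cdot> f \<in> Hom C (Dom C f) X"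
    using assms by (auto simp: Hom_iff)
  then have "\<exists>!h. h \<in> Hom C (Dom C f) P \<and> p0 \<cdot> h = p0 \<cdot> f \<and> p1 \<cdot> h = p1 \<cdot> f"
    using product unfolding is_product_def by blast
  then show ?thesis
    using assms by (metis Hom_iff)
qed

lemma pairing:
  assumes "x \<in> Arr C" "y \<in> Arr C" "Dom C x = Dom C y" "Cod C x = X" "Cod C y = X"
  shows "pairing C P p0 p1 x y \<in> Arr C" "Dom C (pairing C P p0 p1 x y) = Dom C x"
    "Cod C (pairing C P p0 p1 x y) = P"
    "p0 \<cdot> pairing C P p0 p1 x y = x" "p1 \<cdot> pairing C P p0 p1 x y = y"
proof -
  have "x \<in> Hom C (Dom C x) X" "y \<in> Hom C (Dom C x) X"
    using assms by (auto simp: Hom_iff)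
  then have "\<exists>!h. h \<in> Hom C (Dom C x) P \<and> p0 \<cdot> h = x \<and> p1 \<cdot> h = y"
    using product unfolding is_product_def by blast
  from theI'[OF this] show "pairing C P p0 p1 x y \<in> Arr C"
    "Dom C (pairing C P p0 p1 x y) = Dom C x" "Cod C (pairing C P p0 p1 x y) = P"
    "p0 \<cdot> pairing C P p0 p1 x y = x" "p1 \<cdot> pairing C P p0 p1 x y = y"
    unfolding pairing_def Hom_iff by auto
qed

text \<open>The pair \<open>(x, y)\<close> is a generalized element of the relation. Asking for an arrow \<open>w\<close> into the
  product that induces it makes \<open>x\<close> and \<open>y\<close> parallel arrows into \<open>X\<close> automatically.\<close>

definition holds :: "'m set \<Rightarrow> 'm \<Rightarrow> 'm \<Rightarrow> bool" where
  "holds R x y \<longleftrightarrow> (\<exists>w \<in> Arr C. Cod C w = P \<and> p0 \<cdot> w = x \<and> p1 \<cdot> w = y \<and> (\<exists>r\<in>R. factors w r))"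

lemma holds_arr:
  assumes "holds R x y"
  shows "x \<in> Arr C" "y \<in> Arr C" "Dom C x = Dom C y" "Cod C x = X" "Cod C y = X"
  using assms unfolding holds_def by auto

lemma holds_proj:
  assumes "is_rel R" "r \<in> R" "w \<in> Arr C" "Cod C w = P"
  shows "holds R (p0 \<cdot> w) (p1 \<cdot> w) \<longleftrightarrow> factors w r"
proof
  assume "holds R (p0 \<cdot> w) (p1 \<cdot> w)"
  then obtain w' r' where w': "w' \<in> Arr C" "Cod C w' = P" "p0 \<cdot> w' = p0 \<cdot> w" "p1 \<cdot> w' = p1 \<cdot> w"
    "r' \<in> R" "factors w' r'"
    unfolding holds_def by blast
  have "Dom C w' = Dom C w"
    using w'(1-3) assms(3,4) comp_arr(2)[of w' p0] comp_arr(2)[of w p0] by simp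
  then have "w' = w"
    using product_ext w' assms by blast
  then show "factors w r"
    using w' subobject_factors[OF assms(1), of r' r] subobject_member[OF assms(1,2)] assms(2)
      factors_trans by blast
next
  assume "factors w r"
  then show "holds R (p0 \<cdot> w) (p1 \<cdot> w)"
    unfolding holds_def using assms by blast
qed

lemma holds_precomp:
  assumes "is_rel R" "holds R x y" "c \<in> Arr C" "Cod C c = Dom C x"
  shows "holds R (x \<cdot> c) (y \<cdot> c)"
proof -
  obtain w r where w: "w \<in> Arr C" "Cod C w = P" "p0 \<cdot> w = x" "p1 \<cdot> w = y" "r \<in> R" "factors w r"
    using assms(2) unfolding holds_def by blast
  have d: "Dom C w = Dom C x"
    using w(1,2) unfolding w(3)[symmetric] by simp
  have "factors (w \<cdot> c) r"
    using factors_precomp[OF w(6) assms(3)] assms(4) d subobject_member(2)[OF assms(1) w(5)]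
    by simp
  then have "holds R (p0 \<cdot> (w \<cdot> c)) (p1 \<cdot> (w \<cdot> c))"
    using holds_proj[OF assms(1) w(5), of "w \<cdot> c"] w(1,2) assms(3,4) d by simp
  moreover have "p0 \<cdot> (w \<cdot> c) = x \<cdot> c" "p1 \<cdot> (w \<cdot> c) = y \<cdot> c"
    unfolding w(3,4)[symmetric] using w(1,2) assms(3,4) d by (simp_all add: comp_assoc_arr)
  ultimately show ?thesis by simp
qed

text \<open>A monomorphism representing \<open>A\<close> is itself a generalized element of \<open>A\<close>, the generic one, and
  inclusion in \<open>B\<close> need only be tested there.\<close>

lemma rel_le_iff:
  assumes A: "is_rel A" and B: "is_rel B"
  shows "subobject_le C A B \<longleftrightarrow> (\<forall>x y. holds A x y \<longrightarrow> holds B x y)"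
proof
  assume "subobject_le C A B"
  then obtain a b where ab: "a \<in> A" "b \<in> B" "factors a b"
    unfolding subobject_le_def factors_def by blast
  show "\<forall>x y. holds A x y \<longrightarrow> holds B x y"
  proof (intro allI impI)
    fix x y assume h: "holds A x y"
    then obtain w where w: "w \<in> Arr C" "Cod C w = P" "p0 \<cdot> w = x" "p1 \<cdot> w = y"
      unfolding holds_def by blast
    then have "factors w a"
      using h holds_proj[OF A ab(1)] by blast
    then have "factors w b"
      using factors_trans ab(3) subobject_member(2)[OF B ab(2)] by blast
    then show "holds B x y"
      using holds_proj[OF B ab(2)] w by blast
  qed
next
  assume H: "\<forall>x y. holds A x y \<longrightarrow> holds B x y"
  obtain a b where ab: "a \<in> A" "b \<in> B"
    using A B subobject_nonempty by metis
  note a = subobject_member[OF A ab(1)]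
  have "holds A (p0 \<cdot> a) (p1 \<cdot> a)"
    using holds_proj[OF A ab(1)] a factors_refl by blast
  then have "factors a b"
    using H holds_proj[OF B ab(2)] a by blast
  then show "subobject_le C A B"
    using ab unfolding subobject_le_def factors_def by blast
qed

lemma rel_eqI:
  assumes A: "is_rel A" and B: "is_rel B" and eq: "\<And>x y. holds A x y \<longleftrightarrow> holds B x y"
  shows "A = B"
proof -
  obtain a b where ab: "a \<in> A" "b \<in> B"
    using A B subobject_nonempty by metis
  note a = subobject_member[OF A ab(1)] and b = subobject_member[OF B ab(2)]
  have "factors a b"
    using eq[of "p0 \<cdot> a" "p1 \<cdot> a"] holds_proj[OF A ab(1)] holds_proj[OF B ab(2)] a factors_refl
    by blast
  moreover have "factors b a"
    using eq[of "p0 \<cdot> b" "p1 \<cdot> b"] holds_proj[OF A ab(1)] holds_proj[OF B ab(2)] b factors_refl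
    by blast
  ultimately show ?thesis
    using subobject_eqI[OF A ab(1) B ab(2)] by blast
qed

text \<open>The diagonal arrow is monic, because \<open>p0\<close> is a retraction of it, and its generalized elements
  are exactly the pairs \<open>(x, x)\<close>.\<close>

lemma reflexive_iff:
  "reflexive_relation C X P p0 p1 R \<longleftrightarrow>
    is_rel R \<and> (\<forall>x \<in> Arr C. Cod C x = X \<longrightarrow> holds R x x)"
proof (cases "is_rel R")
  case R: True
  define \<delta> where "\<delta> = pairing C P p0 p1 (Ident C X) (Ident C X)"
  have \<delta>: "\<delta> \<in> Arr C" "Dom C \<delta> = X" "Cod C \<delta> = P" "p0 \<cdot> \<delta> = Ident C X" "p1 \<cdot> \<delta> = Ident C X"
    unfolding \<delta>_def using pairing[of "Ident C X" "Ident C X"] base_obj by auto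
  have "u = v" if "u \<in> Hom C A X" "v \<in> Hom C A X" "\<delta> \<cdot> u = \<delta> \<cdot> v" for A u v
  proof -
    have "u = (p0 \<cdot> \<delta>) \<cdot> u" "v = (p0 \<cdot> \<delta>) \<cdot> v"
      using that(1,2) \<delta> by (simp_all add: Hom_iff)
    moreover have "(p0 \<cdot> \<delta>) \<cdot> u = p0 \<cdot> (\<delta> \<cdot> u)" "(p0 \<cdot> \<delta>) \<cdot> v = p0 \<cdot> (\<delta> \<cdot> v)"
      by (rule comp_assoc_arr; use that(1,2) \<delta> in \<open>simp add: Hom_iff\<close>)+
    ultimately show ?thesis
      using that(3) by metis
  qed
  then have mono: "is_mono C \<delta>"
    unfolding is_mono_def using \<delta> by blast
  have diag: "diagonal C X P p0 p1 = subobject_class C \<delta>"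
    unfolding diagonal_def \<delta>_def ..
  have D: "is_rel (subobject_class C \<delta>)"
    unfolding is_subobject_def using mono \<delta> by blast
  have elem: "holds (subobject_class C \<delta>) x y \<longleftrightarrow> x = y \<and> x \<in> Arr C \<and> Cod C x = X" for x y
  proof
    assume h: "holds (subobject_class C \<delta>) x y"
    then obtain w where w: "w \<in> Arr C" "Cod C w = P" "p0 \<cdot> w = x" "p1 \<cdot> w = y"
      unfolding holds_def by blast
    then have "factors w \<delta>"
      using h holds_proj[OF D subobject_class_self[OF mono]] by blast
    then obtain t where t: "t \<in> Arr C" "Cod C t = X" "w = \<delta> \<cdot> t"
      unfolding factors_iff \<delta>(2) by blast
    have "p0 \<cdot> (\<delta> \<cdot> t) = (p0 \<cdot> \<delta>) \<cdot> t" "p1 \<cdot> (\<delta> \<cdot> t) = (p1 \<cdot> \<delta>) \<cdot> t"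
      using t(1,2) \<delta>(1-3) by (simp_all add: comp_assoc_arr)
    then have "x = t" "y = t"
      using w t \<delta>(4,5) by auto
    then show "x = y \<and> x \<in> Arr C \<and> Cod C x = X"
      using t by simp
  next
    assume "x = y \<and> x \<in> Arr C \<and> Cod C x = X"
    then have x: "y = x" "x \<in> Arr C" "Cod C x = X"
      by auto
    have w: "\<delta> \<cdot> x \<in> Arr C" "Cod C (\<delta> \<cdot> x) = P"
      using x \<delta> by auto
    have "p0 \<cdot> (\<delta> \<cdot> x) = (p0 \<cdot> \<delta>) \<cdot> x" "p1 \<cdot> (\<delta> \<cdot> x) = (p1 \<cdot> \<delta>) \<cdot> x"
      using x \<delta>(1-3) by (simp_all add: comp_assoc_arr)
    then have p: "p0 \<cdot> (\<delta> \<cdot> x) = x" "p1 \<cdot> (\<delta> \<cdot> x) = x"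
      using x \<delta>(4,5) by auto
    have "factors (\<delta> \<cdot> x) \<delta>"
      using factors_precomp[OF factors_refl[OF \<delta>(1)]] x \<delta> by simp
    then show "holds (subobject_class C \<delta>) x y"
      using holds_proj[OF D subobject_class_self[OF mono] w] p x by simp
  qed
  show ?thesis
    unfolding reflexive_relation_def diag using R rel_le_iff[OF D R] elem by auto
qed (simp add: reflexive_relation_def)

section \<open>Composition of relations\<close>

text \<open>The typing of \<open>x\<close> and \<open>y\<close> is stated separately, since composition is a total function and
  \<open>x \<cdot> c\<close> and \<open>y \<cdot> c\<close> may be arrows into \<open>X\<close> even where \<open>x\<close> and \<open>y\<close> are not.\<close>

definition chained :: "'m set \<Rightarrow> 'm set \<Rightarrow> 'm \<Rightarrow> 'm \<Rightarrow> bool" where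
  "chained R S x y \<longleftrightarrow> x \<in> Arr C \<and> y \<in> Arr C \<and> Dom C x = Dom C y \<and> Cod C x = X \<and> Cod C y = X \<and>
    (\<exists>c z. cover c \<and> Cod C c = Dom C x \<and> holds R (x \<cdot> c) z \<and> holds S z (y \<cdot> c))"

text \<open>A generalized element of the image lifts along the regular epimorphism of the factorization to
  the pullback, whose elements are the composable pairs. Conversely, a composable pair over a cover
  gives an element of the pullback, hence of the image, and membership in the image is local.\<close>

lemma factors_composite_iff:
  assumes R: "is_rel R" and S: "is_rel S" and m: "m \<in> S \<odot> R"
    and w: "w \<in> Arr C" "Cod C w = P"
  shows "factors w m \<longleftrightarrow> chained R S (p0 \<cdot> w) (p1 \<cdot> w)"
proof -
  obtain r s T q0 q1 e where mono: "is_mono C m" and cod: "Cod C m = P"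
    and r: "r \<in> R" and s: "s \<in> S"
    and pb: "is_pullback C (p1 \<cdot> r) (p0 \<cdot> s) T q0 q1"
    and e: "e \<in> Hom C T (Dom C m)" "is_regular_epi C e"
    and pair: "pairing C P p0 p1 ((p0 \<cdot> r) \<cdot> q0) ((p1 \<cdot> s) \<cdot> q1) = m \<cdot> e"
    using m unfolding rel_comp_def by blast
  note ra = subobject_member[OF R r] and sa = subobject_member[OF S s]
  note q' = pullback_arr[OF pb]
  have q: "q0 \<in> Arr C" "q1 \<in> Arr C" "Dom C q0 = T" "Dom C q1 = T"
    "Cod C q0 = Dom C r" "Cod C q1 = Dom C s"
    using q' ra sa by auto
  have ma: "m \<in> Arr C" and ea: "e \<in> Arr C" "Dom C e = T" "Cod C e = Dom C m"
    using mono mono_arr e by (auto simp: Hom_iff)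
  have me: "p0 \<cdot> (m \<cdot> e) = (p0 \<cdot> r) \<cdot> q0" "p1 \<cdot> (m \<cdot> e) = (p1 \<cdot> s) \<cdot> q1"
    unfolding pair[symmetric] using pairing q ra sa by simp_all
  show ?thesis
  proof
    assume "factors w m"
    then obtain h where h: "h \<in> Arr C" "Dom C h = Dom C w" "Cod C h = Dom C m" "w = m \<cdot> h"
      unfolding factors_iff by blast
    obtain c t where c: "is_regular_epi C c" "Cod C c = Dom C w"
      and t: "t \<in> Arr C" "Dom C t = Dom C c" "Cod C t = T" "h \<cdot> c = e \<cdot> t"
      using regular_epi_lift[OF e(2) h(1)] h ea unfolding Hom_iff by metis
    note ca = regular_epi_arr[OF c(1)]
    have wc: "w \<cdot> c = (m \<cdot> e) \<cdot> t"
      unfolding h(4) using h(1-3) c ca t ma ea by (simp add: comp_assoc_arr)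
    have "p0 \<cdot> (w \<cdot> c) = (p0 \<cdot> (m \<cdot> e)) \<cdot> t" "p1 \<cdot> (w \<cdot> c) = (p1 \<cdot> (m \<cdot> e)) \<cdot> t"
      unfolding wc using t ma ea cod by (simp_all add: comp_assoc_arr)
    then have pw: "(p0 \<cdot> w) \<cdot> c = p0 \<cdot> (r \<cdot> (q0 \<cdot> t))" "(p1 \<cdot> w) \<cdot> c = p1 \<cdot> (s \<cdot> (q1 \<cdot> t))"
      unfolding me using w c ca t q ra sa by (simp_all add: comp_assoc_arr)
    have mid: "p1 \<cdot> (r \<cdot> (q0 \<cdot> t)) = p0 \<cdot> (s \<cdot> (q1 \<cdot> t))"
    proof -
      have "((p1 \<cdot> r) \<cdot> q0) \<cdot> t = ((p0 \<cdot> s) \<cdot> q1) \<cdot> t"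
        using q'(7) by simp
      then show ?thesis
        using q ra sa t by (simp add: comp_assoc_arr)
    qed
    have "factors (r \<cdot> (q0 \<cdot> t)) r" "factors (s \<cdot> (q1 \<cdot> t)) s"
      using factors_precomp[OF factors_refl] q ra sa t by auto
    then have "holds R (p0 \<cdot> (r \<cdot> (q0 \<cdot> t))) (p1 \<cdot> (r \<cdot> (q0 \<cdot> t)))"
      "holds S (p0 \<cdot> (s \<cdot> (q1 \<cdot> t))) (p1 \<cdot> (s \<cdot> (q1 \<cdot> t)))"
      using holds_proj[OF R r] holds_proj[OF S s] q ra sa t by auto
    then have "holds R ((p0 \<cdot> w) \<cdot> c) (p1 \<cdot> (r \<cdot> (q0 \<cdot> t)))"
      "holds S (p1 \<cdot> (r \<cdot> (q0 \<cdot> t))) ((p1 \<cdot> w) \<cdot> c)"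
      unfolding pw mid .
    then show "chained R S (p0 \<cdot> w) (p1 \<cdot> w)"
      unfolding chained_def using regular_epi_cover[OF c(1)] c w by auto
  next
    assume "chained R S (p0 \<cdot> w) (p1 \<cdot> w)"
    then obtain c z where c: "cover c" "Cod C c = Dom C w"
      and hR: "holds R ((p0 \<cdot> w) \<cdot> c) z" and hS: "holds S z ((p1 \<cdot> w) \<cdot> c)"
      unfolding chained_def using w by auto
    note ca = cover_arr[OF c(1)]
    obtain u where u: "u \<in> Arr C" "Cod C u = P" "p0 \<cdot> u = (p0 \<cdot> w) \<cdot> c" "p1 \<cdot> u = z"
      using hR unfolding holds_def by blast
    obtain v where v: "v \<in> Arr C" "Cod C v = P" "p0 \<cdot> v = z" "p1 \<cdot> v = (p1 \<cdot> w) \<cdot> c"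
      using hS unfolding holds_def by blast
    have "factors u r" "factors v s"
      using hR hS u v holds_proj[OF R r] holds_proj[OF S s] by metis+
    then obtain f g where f: "f \<in> Arr C" "Dom C f = Dom C u" "Cod C f = Dom C r" "u = r \<cdot> f"
      and g: "g \<in> Arr C" "Dom C g = Dom C v" "Cod C g = Dom C s" "v = s \<cdot> g"
      unfolding factors_iff by blast
    have du: "Dom C u = Dom C c"
      using comp_arr(2)[of u p0] comp_arr(2)[of c "p0 \<cdot> w"] u(1-3) w c ca by simp
    have dv: "Dom C v = Dom C c"
      using comp_arr(2)[of v p1] comp_arr(2)[of c "p1 \<cdot> w"] v(1,2,4) w c ca by simp
    have "(p1 \<cdot> r) \<cdot> f = p1 \<cdot> u" "(p0 \<cdot> s) \<cdot> g = p0 \<cdot> v"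
      unfolding f(4) g(4) using f(1-3) g(1-3) ra sa by (simp_all add: comp_assoc_arr)
    then have "(p1 \<cdot> r) \<cdot> f = (p0 \<cdot> s) \<cdot> g"
      using u(4) v(3) by simp
    then obtain t where t: "t \<in> Hom C (Dom C c) T" "q0 \<cdot> t = f" "q1 \<cdot> t = g"
      using pullback_factor[OF pb, of f "Dom C c" g] f(1-3) g(1-3) du dv ra(2,3) sa(2,3) by (auto simp: Hom_iff)
    then have ta: "t \<in> Arr C" "Dom C t = Dom C c" "Cod C t = T"
      by (auto simp: Hom_iff)
    have "p0 \<cdot> ((m \<cdot> e) \<cdot> t) = (p0 \<cdot> (m \<cdot> e)) \<cdot> t" "p1 \<cdot> ((m \<cdot> e) \<cdot> t) = (p1 \<cdot> (m \<cdot> e)) \<cdot> t"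
      using ta ma ea cod by (simp_all add: comp_assoc_arr)
    moreover have "((p0 \<cdot> r) \<cdot> q0) \<cdot> t = p0 \<cdot> (r \<cdot> (q0 \<cdot> t))"
      "((p1 \<cdot> s) \<cdot> q1) \<cdot> t = p1 \<cdot> (s \<cdot> (q1 \<cdot> t))"
      using ta q ra(2,3) sa(2,3) by (simp_all add: comp_assoc_arr)
    ultimately have met: "p0 \<cdot> ((m \<cdot> e) \<cdot> t) = p0 \<cdot> u" "p1 \<cdot> ((m \<cdot> e) \<cdot> t) = p1 \<cdot> v"
      unfolding me t(2,3) by (simp_all flip: f(4) g(4))
    have wc: "(p0 \<cdot> w) \<cdot> c = p0 \<cdot> (w \<cdot> c)" "(p1 \<cdot> w) \<cdot> c = p1 \<cdot> (w \<cdot> c)"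
      using w c ca by (simp_all add: comp_assoc_arr)
    have "(m \<cdot> e) \<cdot> t = w \<cdot> c"
      by (rule product_ext[OF _ _ _ _ _ met(1)[unfolded u(3) wc(1)] met(2)[unfolded v(4) wc(2)]])
        (use ta ma ea cod w c ca in auto)
    moreover have "(m \<cdot> e) \<cdot> t = m \<cdot> (e \<cdot> t)"
      using ta ma ea by (simp add: comp_assoc_arr)
    ultimately have "w \<cdot> c = m \<cdot> (e \<cdot> t)"
      by simp
    moreover have "e \<cdot> t \<in> Hom C (Dom C (w \<cdot> c)) (Dom C m)"
      using ta ea w c ca by (simp add: Hom_iff)
    ultimately have "factors (w \<cdot> c) m"
      unfolding factors_def by blast
    then show "factors w m"
      using cover_local[OF c(1) _ mono] w c cod by simp
  qed
qed

lemma composite_memberI: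
  assumes "is_mono C m" "Cod C m = P" "r \<in> R" "s \<in> S"
    "is_pullback C (p1 \<cdot> r) (p0 \<cdot> s) T q0 q1" "e \<in> Hom C T (Dom C m)" "is_regular_epi C e"
    "pairing C P p0 p1 ((p0 \<cdot> r) \<cdot> q0) ((p1 \<cdot> s) \<cdot> q1) = m \<cdot> e"
  shows "m \<in> S \<odot> R"
  unfolding rel_comp_def using assms by blast

lemma composite_nonempty:
  assumes R: "is_rel R" and S: "is_rel S"
  obtains m where "m \<in> S \<odot> R"
proof -
  obtain r s where r: "r \<in> R" and s: "s \<in> S"
    using R S subobject_nonempty by metis
  note ra = subobject_member[OF R r] and sa = subobject_member[OF S s]
  obtain T q0 q1 where pb: "is_pullback C (p1 \<cdot> r) (p0 \<cdot> s) T q0 q1"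
    using pullback_exists[of "p1 \<cdot> r" "p0 \<cdot> s"] ra sa by auto
  have q: "q0 \<in> Arr C" "q1 \<in> Arr C" "Dom C q0 = T" "Dom C q1 = T"
    "Cod C q0 = Dom C r" "Cod C q1 = Dom C s"
    using pullback_arr[OF pb] ra sa by auto
  let ?f = "pairing C P p0 p1 ((p0 \<cdot> r) \<cdot> q0) ((p1 \<cdot> s) \<cdot> q1)"
  have f: "?f \<in> Arr C" "Dom C ?f = T" "Cod C ?f = P"
    using pairing[of "(p0 \<cdot> r) \<cdot> q0" "(p1 \<cdot> s) \<cdot> q1"] q ra sa by auto
  obtain m e where me: "is_mono C m" "is_regular_epi C e" "Cod C e = Dom C m" "?f = m \<cdot> e"
    using image_factorization[OF f(1)] by blast
  have a: "m \<in> Arr C" "e \<in> Arr C"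
    using me mono_arr regular_epi_arr by auto
  have "Dom C e = T" "Cod C m = P"
    using comp_arr[of e m] f me(3) a unfolding me(4) by auto
  then have "m \<in> S \<odot> R"
    by (intro composite_memberI[OF me(1) _ r s pb _ me(2,4)]) (simp_all add: Hom_iff a me(3))
  then show ?thesis
    by (rule that)
qed

text \<open>Any two members of the composite have the same generalized elements by the previous
  characterization, whatever representatives, pullback and factorization they come from. Conversely,
  an isomorphism of subobjects can be absorbed into the regular epimorphism of the factorization.\<close>

lemma composite_rel:
  assumes R: "is_rel R" and S: "is_rel S"
  shows "is_rel (S \<odot> R)"
proof -
  obtain m where m: "m \<in> S \<odot> R"
    using composite_nonempty[OF R S] .
  obtain r s T q0 q1 e where mono: "is_mono C m" and cod: "Cod C m = P"
    and rs: "r \<in> R" "s \<in> S"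
    and pb: "is_pullback C (p1 \<cdot> r) (p0 \<cdot> s) T q0 q1"
    and e: "e \<in> Hom C T (Dom C m)" "is_regular_epi C e"
    and pair: "pairing C P p0 p1 ((p0 \<cdot> r) \<cdot> q0) ((p1 \<cdot> s) \<cdot> q1) = m \<cdot> e"
    using m unfolding rel_comp_def by blast
  have ma: "m \<in> Arr C" and ea: "e \<in> Arr C" "Dom C e = T" "Cod C e = Dom C m"
    using mono mono_arr e by (auto simp: Hom_iff)
  have "S \<odot> R = subobject_class C m"
  proof (intro set_eqI iffI)
    fix m' assume m': "m' \<in> S \<odot> R"
    then have mono': "is_mono C m'" and cod': "Cod C m' = P"
      unfolding rel_comp_def by auto
    have "factors m m'" "factors m' m"
      using factors_composite_iff[OF R S m] factors_composite_iff[OF R S m']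
        mono_arr[OF mono] mono_arr[OF mono'] cod cod' factors_refl by blast+
    then show "m' \<in> subobject_class C m"
      using in_subobject_class_iff[OF mono] mono' cod cod' by simp
  next
    fix m' assume "m' \<in> subobject_class C m"
    then have m': "is_mono C m'" "Cod C m' = P" "factors m m'" "factors m' m"
      using in_subobject_class_iff[OF mono] cod by auto
    obtain i j where ij: "i \<in> Hom C (Dom C m') (Dom C m)" "j \<in> Hom C (Dom C m) (Dom C m')"
      "m' = m \<cdot> i" "m = m' \<cdot> j" "j \<cdot> i = Ident C (Dom C m')" "i \<cdot> j = Ident C (Dom C m)"
      by (rule mutual_factors_iso[OF mono m'(1,3,4)])
    have "is_regular_epi C (j \<cdot> e)"
      using regular_epi_postcomp_iso[OF e(2)] ij ea by metis
    moreover have "j \<cdot> e \<in> Hom C T (Dom C m')"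
      using ij(2) ea by (simp add: Hom_iff)
    moreover have "m \<cdot> e = m' \<cdot> (j \<cdot> e)"
    proof -
      have "(m' \<cdot> j) \<cdot> e = m' \<cdot> (j \<cdot> e)"
        using ij(2) ea mono_arr[OF m'(1)] by (simp add: Hom_iff comp_assoc_arr)
      then show ?thesis
        using ij(4) by simp
    qed
    ultimately show "m' \<in> S \<odot> R"
      using composite_memberI[OF m'(1,2) rs pb] pair by simp
  qed
  then show ?thesis
    unfolding is_subobject_def using mono cod by blast
qed

text \<open>From here on a composite is known only through this description; pullbacks and factorizations
  no longer appear.\<close>

lemma holds_rel_comp:
  assumes R: "is_rel R" and S: "is_rel S"
  shows "holds (S \<odot> R) x y \<longleftrightarrow> chained R S x y"
proof -
  obtain m where m: "m \<in> S \<odot> R"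
    using composite_nonempty[OF R S] .
  note iff = holds_proj[OF composite_rel[OF R S] m] factors_composite_iff[OF R S m]
  show ?thesis
  proof
    assume h: "holds (S \<odot> R) x y"
    then obtain w where w: "w \<in> Arr C" "Cod C w = P" "p0 \<cdot> w = x" "p1 \<cdot> w = y"
      unfolding holds_def by blast
    then show "chained R S x y"
      using iff[OF w(1,2)] h by simp
  next
    assume ch: "chained R S x y"
    then have "x \<in> Arr C" "y \<in> Arr C" "Dom C x = Dom C y" "Cod C x = X" "Cod C y = X"
      unfolding chained_def by auto
    from pairing[OF this] ch show "holds (S \<odot> R) x y"
      using iff by metis
  qed
qed

abbreviation rel_le :: "'m set \<Rightarrow> 'm set \<Rightarrow> bool" (infix "\<sqsubseteq>" 50) where
  "A \<sqsubseteq> B \<equiv> \<forall>x y. holds A x y \<longrightarrow> holds B x y"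

abbreviation reflexive :: "'m set \<Rightarrow> bool" where
  "reflexive \<equiv> reflexive_relation C X P p0 p1"

lemma reflexive_rel: "reflexive R \<Longrightarrow> is_rel R"
  by (simp add: reflexive_iff)

lemma reflexive_holds: "reflexive R \<Longrightarrow> x \<in> Arr C \<Longrightarrow> Cod C x = X \<Longrightarrow> holds R x x"
  by (simp add: reflexive_iff)

lemma transitive_iff:
  "transitive_relation C P p0 p1 R \<longleftrightarrow> is_rel R \<and> R \<odot> R \<sqsubseteq> R"
  unfolding transitive_relation_def using rel_le_iff composite_rel by blast

lemma composite_elementE:
  assumes "is_rel R" "is_rel S" "holds (S \<odot> R) x y"
  obtains c z where "cover c" "Cod C c = Dom C x" "holds R (x \<cdot> c) z" "holds S z (y \<cdot> c)"
  using assms unfolding holds_rel_comp[OF assms(1,2)] chained_def by blast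

lemma composite_elementI:
  assumes "is_rel R" "is_rel S" "x \<in> Arr C" "y \<in> Arr C" "Dom C x = Dom C y"
    "Cod C x = X" "Cod C y = X" "cover c" "Cod C c = Dom C x"
    "holds R (x \<cdot> c) z" "holds S z (y \<cdot> c)"
  shows "holds (S \<odot> R) x y"
  using assms unfolding holds_rel_comp[OF assms(1,2)] chained_def by blast

lemma composite_global:
  assumes R: "is_rel R" and S: "is_rel S" and "holds R x z" "holds S z y"
  shows "holds (S \<odot> R) x y"
proof -
  note x = holds_arr[OF assms(3)] and y = holds_arr[OF assms(4)]
  have "Dom C x \<in> Obj C"
    using x dom_obj by blast
  then show ?thesis
    using composite_elementI[OF R S _ _ _ _ _ cover_ident, of x y "Dom C x" z] x y assms(3,4)
    by simp
qed

lemma composite_le_right: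
  assumes "is_rel A" "reflexive B"
  shows "A \<sqsubseteq> B \<odot> A"
  using composite_global[OF assms(1) reflexive_rel[OF assms(2)]] reflexive_holds[OF assms(2)]
    holds_arr by blast

lemma composite_le_left:
  assumes "reflexive A" "is_rel B"
  shows "B \<sqsubseteq> B \<odot> A"
  using composite_global[OF reflexive_rel[OF assms(1)] assms(2)] reflexive_holds[OF assms(1)]
    holds_arr by blast

lemma composite_mono:
  assumes rels: "is_rel A" "is_rel A'" "is_rel B" "is_rel B'" and le: "A \<sqsubseteq> A'" "B \<sqsubseteq> B'"
  shows "B \<odot> A \<sqsubseteq> B' \<odot> A'"
proof (intro allI impI)
  fix x y assume h: "holds (B \<odot> A) x y"
  obtain c z where "cover c" "Cod C c = Dom C x" "holds A (x \<cdot> c) z" "holds B z (y \<cdot> c)"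
    using composite_elementE[OF rels(1,3) h] .
  then show "holds (B' \<odot> A') x y"
    using composite_elementI[OF rels(2,4)] holds_arr[OF h] le by blast
qed

lemma composite_reflexive:
  assumes "reflexive A" "reflexive B"
  shows "reflexive (B \<odot> A)"
  using composite_rel composite_le_right assms reflexive_rel unfolding reflexive_iff by blast

text \<open>The two middle elements of a triple composite are found over successive covers; restricting the
  outer one to the smaller cover allows the factors to be bracketed the other way.\<close>

lemma composite_assoc_le:
  assumes A: "is_rel A" and B: "is_rel B" and D: "is_rel D"
  shows "D \<odot> (B \<odot> A) \<sqsubseteq> (D \<odot> B) \<odot> A"
proof (intro allI impI)
  fix x y assume h: "holds (D \<odot> (B \<odot> A)) x y"
  note xy = holds_arr[OF h]
  obtain c z where c: "cover c" "Cod C c = Dom C x"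
    and z: "holds (B \<odot> A) (x \<cdot> c) z" "holds D z (y \<cdot> c)"
    using composite_elementE[OF composite_rel[OF A B] D h] .
  note ca = cover_arr[OF c(1)]
  obtain d z' where d: "cover d" "Cod C d = Dom C (x \<cdot> c)"
    and z': "holds A ((x \<cdot> c) \<cdot> d) z'" "holds B z' (z \<cdot> d)"
    using composite_elementE[OF A B z(1)] .
  note da = cover_arr[OF d(1)]
  have dc: "Cod C d = Dom C c" "Dom C z = Dom C c"
    using d(2) holds_arr(3)[OF z(1)] xy c ca by auto
  have "holds D (z \<cdot> d) ((y \<cdot> c) \<cdot> d)"
    using holds_precomp[OF D z(2)] da dc by simp
  then have "holds (D \<odot> B) z' ((y \<cdot> c) \<cdot> d)"
    using composite_global[OF B D z'(2)] by blast
  moreover have "(x \<cdot> c) \<cdot> d = x \<cdot> (c \<cdot> d)" "(y \<cdot> c) \<cdot> d = y \<cdot> (c \<cdot> d)"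
    using xy c ca da dc by (simp_all add: comp_assoc_arr)
  ultimately have elems: "holds A (x \<cdot> (c \<cdot> d)) z'" "holds (D \<odot> B) z' (y \<cdot> (c \<cdot> d))"
    using z'(1) by simp_all
  have "Cod C (c \<cdot> d) = Dom C x"
    using c(2) ca da dc(1) by simp
  then show "holds ((D \<odot> B) \<odot> A) x y"
    by (rule composite_elementI[OF A composite_rel[OF B D] xy cover_comp[OF c(1) d(1) dc(1)] _ elems])
qed

end

section \<open>The alternating chain\<close>

locale alternating_chain = relations_on C X P p0 p1
  for C :: "('o, 'm) precategory" (structure) and X P :: 'o and p0 p1 :: 'm +
  fixes R S :: "'m set"
  assumes R_refl: "reflexive R" and S_refl: "reflexive S"
begin

abbreviation chain :: "nat \<Rightarrow> 'm set" where
  "chain \<equiv> alt_prod C X P p0 p1 R S"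

definition absorbing :: "'m set \<Rightarrow> bool" where
  "absorbing V \<longleftrightarrow> V \<odot> R = V \<and> V \<odot> S = V"

lemma chain_reflexive: "reflexive (chain (Suc n))"
  by (induction n) (use R_refl S_refl in \<open>auto intro: composite_reflexive\<close>)

lemmas chain_rel = reflexive_rel[OF chain_reflexive]

lemma chain_le_Suc: "chain (Suc n) \<sqsubseteq> chain (Suc (Suc n))"
  using composite_le_left[OF _ chain_rel] R_refl S_refl by (cases "even n") simp_all

lemma chain_mono: "m \<le> n \<Longrightarrow> chain (Suc m) \<sqsubseteq> chain (Suc n)"
proof (induction rule: dec_induct)
  case (step k)
  then show ?case
    using chain_le_Suc by blast
qed simp

text \<open>Two consecutive steps of the chain append one factor \<open>R\<close> and one factor \<open>S\<close>.\<close>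

lemma period_two_absorbing:
  assumes eq: "chain (Suc n + 2) = chain (Suc n)"
  shows "absorbing (chain (Suc n))"
proof -
  have "chain (Suc (Suc n)) \<sqsubseteq> chain (Suc n)"
    using chain_le_Suc[of "Suc n"] eq by simp
  then have eq1: "chain (Suc (Suc n)) = chain (Suc n)"
    using rel_eqI[OF chain_rel chain_rel] chain_le_Suc by blast
  have "chain (Suc n) \<odot> (if even n then S else R) = chain (Suc n)"
    using eq1 by simp
  moreover have "chain (Suc (Suc n)) \<odot> (if even n then R else S) = chain (Suc n)"
    using eq by (simp split: if_splits)
  ultimately show ?thesis
    unfolding absorbing_def eq1 by (simp split: if_splits)
qed

lemma absorbing_stationary:
  assumes "absorbing (chain (Suc n))"
  shows "chain (Suc n + k) = chain (Suc n)"
  by (induction k) (use assms in \<open>auto simp: absorbing_def\<close>)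

text \<open>By associativity, the factors of the right-hand copy are absorbed one at a time.\<close>

lemma absorbing_chain:
  assumes V: "is_rel V" and abs: "absorbing V"
  shows "V \<odot> chain (Suc k) \<sqsubseteq> V"
proof (induction k)
  case 0
  then show ?case
    using abs by (simp add: absorbing_def)
next
  case (Suc k)
  define A where "A = (if even k then S else R)"
  have A: "is_rel A" "V \<odot> A = V"
    using abs R_refl S_refl reflexive_rel unfolding A_def absorbing_def by auto
  have "V \<odot> (chain (Suc k) \<odot> A) \<sqsubseteq> (V \<odot> chain (Suc k)) \<odot> A"
    by (rule composite_assoc_le[OF A(1) chain_rel V])
  moreover have "(V \<odot> chain (Suc k)) \<odot> A \<sqsubseteq> V \<odot> A"
    using composite_mono[OF A(1) A(1) composite_rel[OF chain_rel V] V] Suc by blast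
  ultimately show ?case
    using A(2) unfolding A_def by simp
qed

lemma absorbing_preorder:
  assumes "absorbing (chain (Suc n))"
  shows "preorder_relation C X P p0 p1 (chain (Suc n))"
  unfolding preorder_relation_def transitive_iff
  using chain_reflexive chain_rel absorbing_chain[OF chain_rel assms] by blast

text \<open>From index \<open>2\<close> on the terms contain both \<open>R\<close> and \<open>S\<close>. This fails at index \<open>1\<close>, where a preorder
  \<open>R\<close> need not absorb \<open>S\<close>.\<close>

lemma preorder_absorbing:
  assumes pre: "preorder_relation C X P p0 p1 (chain (Suc n))" and "n \<ge> 1"
  shows "absorbing (chain (Suc n))"
proof -
  let ?V = "chain (Suc n)"
  have rels: "is_rel R" "is_rel S"
    using R_refl S_refl reflexive_rel by auto
  have trans: "?V \<odot> ?V \<sqsubseteq> ?V"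
    using pre unfolding preorder_relation_def transitive_iff by blast
  have "R \<odot> S \<sqsubseteq> ?V"
    using chain_mono[OF assms(2)] by simp
  then have le: "R \<sqsubseteq> ?V" "S \<sqsubseteq> ?V"
    using composite_le_left[OF S_refl rels(1)] composite_le_right[OF rels(2) R_refl] by blast+
  have "?V \<odot> A = ?V" if A: "reflexive A" "A \<sqsubseteq> ?V" for A
  proof (rule rel_eqI)
    show rel: "is_rel (?V \<odot> A)" "is_rel ?V"
      using composite_rel[OF reflexive_rel[OF A(1)] chain_rel] chain_rel by blast+
    have "?V \<odot> A \<sqsubseteq> ?V \<odot> ?V"
      using composite_mono[OF reflexive_rel[OF A(1)] chain_rel chain_rel chain_rel A(2)] by blast
    then show "holds (?V \<odot> A) x y \<longleftrightarrow> holds ?V x y" for x y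
      using trans composite_le_left[OF A(1) chain_rel] by blast
  qed
  then show ?thesis
    unfolding absorbing_def using R_refl S_refl le by blast
qed

end

theorem lemma6p2:
  fixes C :: "('o, 'm) precategory" and X P :: 'o and p0 p1 :: 'm and R S :: "'m set" and n :: nat
  assumes "regular_category C"
    and "X \<in> Obj C"
    and "is_product C X X P p0 p1"
    and "reflexive_relation C X P p0 p1 R"
    and "reflexive_relation C X P p0 p1 S"
    and "n \<ge> 2"
  shows "(alt_prod C X P p0 p1 R S (n + 2) = alt_prod C X P p0 p1 R S n \<longleftrightarrow>
          (\<forall>k\<ge>1. alt_prod C X P p0 p1 R S (n + k) = alt_prod C X P p0 p1 R S n)) \<and>
         ((\<forall>k\<ge>1. alt_prod C X P p0 p1 R S (n + k) = alt_prod C X P p0 p1 R S n) \<longleftrightarrow>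
          preorder_relation C X P p0 p1 (alt_prod C X P p0 p1 R S n))"
proof -
  interpret alternating_chain C X P p0 p1 R S
    using assms
    by (intro alternating_chain.intro alternating_chain_axioms.intro relations_on.intro
        relations_on_axioms.intro)
  obtain m where n: "n = Suc m" and m: "m \<ge> 1"
    using assms(6) by (cases n) auto
  have "absorbing (chain n)" if "chain (n + 2) = chain n"
    using that period_two_absorbing unfolding n by blast
  moreover have "\<forall>k\<ge>1. chain (n + k) = chain n" if "absorbing (chain n)"
    using that absorbing_stationary unfolding n by blast
  moreover have "chain (n + 2) = chain n" if "\<forall>k\<ge>1. chain (n + k) = chain n"
    by (rule that[rule_format]) simp
  moreover have "preorder_relation C X P p0 p1 (chain n) \<longleftrightarrow> absorbing (chain n)"
    using absorbing_preorder preorder_absorbing m unfolding n by blast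
  ultimately show ?thesis
    by blast
qed

end
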